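(* Let $R$ be a finite (commutative, unital) ring, and let $T: R[y] \to R[y]$ be an $R$-linear operator satisfying: (1) $T$ lowers degrees: $\deg T(f) < \deg f$ for every nonzero $f \in R[y]$; (2) there exist $a_1, \ldots, a_d \in R[y]$ with $\deg a_i \leq i$ for each $i$, such that for all $n \geq d$, $$T(y^n) = a_1 T(y^{n-1}) + \cdots + a_d T(y^{n-d});$$ (3) the coefficient of $y^d$ in $a_d$ is invertible in $R$. Then there exists a constant $\alpha < 1$ such that $N_T(y^n) \ll n^\alpha$.
   Context: For a polynomial $f = \sum c_n y^n \neq 0$, $\deg f = \max\{n : c_n \neq 0\}$, and $\deg 0 = -\infty$. If $T$ is locally nilpotent (every element is killed by some power of $T$), the nilpotence index of $f \neq 0$ is $N_T(f) := \max\{k \geq 0 : T^k f \neq 0\}$, and $N_T(0) := -\infty$. The notation $g(n) \ll h(n)$ means $g(n) \leq C h(n)$ for some constant $C$ and all sufficiently large $n$. *)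

theory Defs
  imports Complex_Main "HOL-Library.Extended_Real" "HOL-Computational_Algebra.Polynomial"
begin

(* The library's degree sends 0 to 0; here deg 0 is minus infinity. *)
definition deg :: "'a::zero poly \<Rightarrow> ereal" where
  "deg f = (if f = 0 then -\<infinity> else ereal (real (degree f)))"

(* Meaningful when T is locally nilpotent with T 0 = 0: the set is then finite and contains 0
   for every nonzero f.  An operator on polynomials that lowers degrees and is linear
   is of this kind. *)
definition nilpotence_index :: "('b::zero \<Rightarrow> 'b) \<Rightarrow> 'b \<Rightarrow> ereal" where
  "nilpotence_index T f =
     (if f = 0 then -\<infinity> else ereal (real (Max {k. (T ^^ k) f \<noteq> 0})))"

(* Vinogradov's relation, one-sided as in the definition g n <= C h n: no absolute values.
   The constant C is real, so it cannot be infinite. *)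
definition vinogradov_le :: "(nat \<Rightarrow> ereal) \<Rightarrow> (nat \<Rightarrow> real) \<Rightarrow> bool" (infix \<open>\<lless>\<close> 50) where
  "g \<lless> h \<longleftrightarrow> (\<exists>C::real. \<forall>\<^sub>F n in sequentially. g n \<le> ereal (C * h n))"

end

theory Submission
  imports Defs "HOL-Computational_Algebra.Primes"
begin

text \<open>
  Write the recursion as a polynomial \<open>P \<in> R[y][X]\<close> that annihilates \<open>n \<mapsto> T(y^n)\<close>, where \<open>X\<close> acts
  as the shift. The form of top total degree of \<open>P\<close> is monic in \<open>X\<close> with invertible \<open>y^d\<close>
  coefficient, so by finiteness of \<open>R\<close> it divides some \<open>X^M - y^M\<close>; hence some multiple of \<open>P\<close> is
  \<open>X^M - y^M\<close> minus terms of lower total degree. Modulo a prime \<open>p\<close>, Frobenius turns this into a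
  recursion of order \<open>M p^k\<close> with steps divisible by \<open>p^k\<close>, for every \<open>k\<close>.

  Weigh \<open>y^n\<close> by the base-\<open>p\<close> digits of the quotient \<open>n div M\<close>, the digit at place \<open>i\<close> counting
  \<open>\<beta>^i\<close> with \<open>\<beta>\<close> slightly below \<open>p\<close>, plus the fraction \<open>(n mod M) / M\<close>. For
  \<open>M p^k \<le> n < M p^(k+1)\<close> the main term only lowers and raises the leading digit, and the loss due to
  carries in the other terms, proportional to \<open>p - \<beta>\<close>, is absorbed by their lower total degree.
  So modulo \<open>p\<close> every application of \<open>T\<close> lowers the weight by at least \<open>1/M\<close>, while the weight of
  \<open>y^n\<close> is \<open>O(n^\<alpha>)\<close> with \<open>\<alpha> = log \<beta> / log p\<close>. Treating the prime factors of the characteristic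
  of \<open>R\<close> one after the other gives the theorem.
\<close>

section \<open>Digit weights\<close>

text \<open>The base \<open>b\<close> expansion of \<open>n\<close>, evaluated at \<beta> in place
  of \<open>b\<close>. The guard restricts the recursive call to cases with
  \<open>n div b < n\<close>.\<close>

function digit_content :: "nat \<Rightarrow> real \<Rightarrow> nat \<Rightarrow> real" where
  "digit_content b \<beta> n =
     (if b < 2 \<or> n = 0 then 0 else real (n mod b) + \<beta> * digit_content b \<beta> (n div b))"
  by pat_completeness auto
termination by (relation "measure (\<lambda>(b, \<beta>, n). n)") auto

declare digit_content.simps [simp del]

lemma digit_content_0 [simp]: "digit_content b \<beta> 0 = 0"
  by (simp add: digit_content.simps)

lemma digit_content_rec:
  "b \<ge> 2 \<Longrightarrow> digit_content b \<beta> n = real (n mod b) + \<beta> * digit_content b \<beta> (n div b)"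
  by (cases "n = 0") (simp_all add: digit_content.simps)

lemma digit_content_less: "b \<ge> 2 \<Longrightarrow> n < b \<Longrightarrow> digit_content b \<beta> n = real n"
  by (simp add: digit_content_rec)

lemma digit_content_nonneg: "\<beta> \<ge> 0 \<Longrightarrow> digit_content b \<beta> n \<ge> 0"
  by (induction b \<beta> n rule: digit_content.induct) (subst digit_content.simps, auto)

lemma digit_content_ge_1:
  assumes "b \<ge> 2" "\<beta> \<ge> 1" "n \<ge> 1"
  shows "digit_content b \<beta> n \<ge> 1"
  using assms(3)
proof (induction n rule: less_induct)
  case (less n)
  show ?case
  proof (cases "n mod b = 0")
    case True
    then have "n div b \<ge> 1" "n div b < n"
      using less.prems assms(1) by (auto simp: Suc_le_eq div_greater_zero_iff intro!: dvd_imp_le)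
    then have "1 * 1 \<le> \<beta> * digit_content b \<beta> (n div b)"
      using less.IH assms(2) by (intro mult_mono) auto
    then show ?thesis by (simp add: digit_content_rec[OF assms(1), of _ n])
  next
    case False
    then have "1 \<le> real (n mod b)" by linarith
    moreover have "0 \<le> \<beta> * digit_content b \<beta> (n div b)"
      using assms(2) by (simp add: digit_content_nonneg)
    ultimately show ?thesis by (simp add: digit_content_rec[OF assms(1), of _ n])
  qed
qed

lemma digit_content_mult_power:
  assumes "b \<ge> 2"
  shows "digit_content b \<beta> (n * b ^ k) = \<beta> ^ k * digit_content b \<beta> n"
proof (induction k)
  case (Suc k)
  have "n * b ^ Suc k mod b = 0" "n * b ^ Suc k div b = n * b ^ k"
    using assms by (simp_all add: mult.left_commute)
  then show ?case
    using Suc digit_content_rec[OF assms, of \<beta> "n * b ^ Suc k"] by simp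
qed simp

text \<open>In column addition the incoming carry \<open>e\<close> is at most 1, hence so is the
  outgoing one. The rule serves both for digits in base \<open>b\<close> and for remainders modulo
  \<open>d\<close>.\<close>

lemma add_carry:
  fixes b x y e :: nat
  assumes "b > 0" "e \<le> 1"
  obtains (no_carry) "(x + y + e) div b = x div b + y div b"
        "real ((x + y + e) mod b) = real (x mod b) + real (y mod b) + real e"
    | (carry) "(x + y + e) div b = x div b + y div b + 1"
        "real ((x + y + e) mod b) = real (x mod b) + real (y mod b) + real e - real b"
proof -
  define r where "r = x mod b + y mod b + e"
  have *: "x + y + e = (x div b + y div b) * b + r"
    unfolding r_def using div_mult_mod_eq[of x b] div_mult_mod_eq[of y b]
    by (simp add: algebra_simps)
  have "x mod b < b" "y mod b < b" using assms by auto
  then have r: "r < 2 * b" unfolding r_def using assms by linarith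
  show thesis
  proof (cases "r < b")
    case True
    then show thesis using no_carry * by (simp add: r_def)
  next
    case False
    then have "r = b + (r - b)" "r - b < b" using r by auto
    then have "x + y + e = (x div b + y div b + 1) * b + (r - b)"
      using * by (simp add: algebra_simps)
    then have "(x + y + e) div b = x div b + y div b + 1" "(x + y + e) mod b = r - b"
      using \<open>r - b < b\<close> by (simp_all only: div_mult_self3 mod_mult_self3) auto
    then show thesis using carry False by (simp add: r_def of_nat_diff)
  qed
qed

text \<open>A carry replaces \<open>b\<close> units at one place by a single unit at the next, which
  never raises the content since \<beta> \<le> b. The carry \<open>e\<close> makes the claim stable
  under passing to quotients by \<open>b\<close>.\<close>

lemma digit_content_add_le:
  assumes "b \<ge> 2" "0 \<le> \<beta>" "\<beta> \<le> real b" "e \<le> 1"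
  shows "digit_content b \<beta> (x + y + e)
    \<le> digit_content b \<beta> x + digit_content b \<beta> y + real e"
  using assms(4)
proof (induction "x + y + e" arbitrary: x y e rule: less_induct)
  case less
  show ?case
  proof (cases "x + y + e < b")
    case True
    then show ?thesis using assms(1) by (simp add: digit_content_less)
  next
    case False
    note rec = digit_content_rec[OF assms(1), of \<beta>]
    have b: "b > 0" using assms(1) by simp
    from b less.prems show ?thesis
    proof (cases rule: add_carry[of b e x y])
      case no_carry
      have "x div b + y div b + 0 < x + y + e"
        using False assms(1) div_less_dividend[of b "x + y + e"] no_carry(1) by linarith
      from less.hyps[OF this] have "digit_content b \<beta> (x div b + y div b)
          \<le> digit_content b \<beta> (x div b) + digit_content b \<beta> (y div b)"
        by simp
      from mult_left_mono[OF this assms(2)] show ?thesis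
        using no_carry by (simp add: rec[of "x + y + e"] rec[of x] rec[of y] distrib_left)
    next
      case carry
      have "x div b + y div b + 1 < x + y + e"
        using False assms(1) div_less_dividend[of b "x + y + e"] carry(1) by linarith
      from less.hyps[OF this] have "digit_content b \<beta> (x div b + y div b + 1)
          \<le> digit_content b \<beta> (x div b) + digit_content b \<beta> (y div b) + 1"
        by simp
      from mult_left_mono[OF this assms(2)] show ?thesis
        using carry assms(3)
        by (simp add: rec[of "x + y + e"] rec[of x] rec[of y] distrib_left)
    qed
  qed
qed

text \<open>A carry out of place \<open>j\<close> loses exactly (b - \<beta>) \<beta>^j, and a sum
  below \<open>b ^ Suc k\<close> can only carry out of places \<open>j < k\<close>.\<close>

lemma digit_content_add_ge:
  assumes "b \<ge> 2" "0 \<le> \<beta>" "\<beta> \<le> real b" "e \<le> 1" "x + y + e < b ^ Suc k"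
  shows "digit_content b \<beta> x + digit_content b \<beta> y + real e
    \<le> digit_content b \<beta> (x + y + e) + (real b - \<beta>) * (\<Sum>j<k. \<beta> ^ j)"
  using assms(4,5)
proof (induction k arbitrary: x y e)
  case 0
  then show ?case using assms(1) by (simp add: digit_content_less)
next
  case (Suc k)
  note rec = digit_content_rec[OF assms(1), of \<beta>]
  have sum: "(\<Sum>j<Suc k. \<beta> ^ j) = 1 + \<beta> * (\<Sum>j<k. \<beta> ^ j)"
    by (simp add: sum.lessThan_Suc_shift sum_distrib_left del: sum.lessThan_Suc)
  have lt: "(x + y + e) div b < b ^ Suc k"
    using Suc.prems(2) assms(1) by (simp add: less_mult_imp_div_less mult.commute)
  have b: "b > 0" using assms(1) by simp
  from b Suc.prems(1) show ?case
  proof (cases rule: add_carry[of b e x y])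
    case no_carry
    have "digit_content b \<beta> (x div b) + digit_content b \<beta> (y div b)
        \<le> digit_content b \<beta> (x div b + y div b) + (real b - \<beta>) * (\<Sum>j<k. \<beta> ^ j)"
      using Suc.IH[of 0 "x div b" "y div b"] lt no_carry(1) by simp
    from mult_left_mono[OF this assms(2)] show ?thesis
      using no_carry assms(3) unfolding sum rec[of "x + y + e"] rec[of x] rec[of y]
      by (simp add: distrib_left right_diff_distrib left_diff_distrib mult.left_commute)
  next
    case carry
    have "digit_content b \<beta> (x div b) + digit_content b \<beta> (y div b) + 1
        \<le> digit_content b \<beta> (x div b + y div b + 1) + (real b - \<beta>) * (\<Sum>j<k. \<beta> ^ j)"
      using Suc.IH[of 1 "x div b" "y div b"] lt carry(1) by simp
    from mult_left_mono[OF this assms(2)] show ?thesis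
      using carry unfolding sum rec[of "x + y + e"] rec[of x] rec[of y]
      by (simp add: distrib_left right_diff_distrib left_diff_distrib mult.left_commute)
  qed
qed

text \<open>The digit at place \<open>k\<close> is the leading one and nonzero, so subtracting
  \<open>b ^ k\<close> borrows nothing.\<close>

lemma digit_content_diff_power:
  assumes "b \<ge> 2" "b ^ k \<le> n" "n < b ^ Suc k"
  shows "digit_content b \<beta> n = digit_content b \<beta> (n - b ^ k) + \<beta> ^ k"
  using assms(2,3)
proof (induction k arbitrary: n)
  case 0
  then show ?case using assms(1) by (simp add: digit_content_less)
next
  case (Suc k)
  note rec = digit_content_rec[OF assms(1), of \<beta>]
  have "b ^ k \<le> n div b"
    using div_le_mono[OF Suc.prems(1), of b] assms(1) by simp
  moreover have "n div b < b ^ Suc k"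
    using Suc.prems(2) assms(1) by (simp add: less_mult_imp_div_less mult.commute)
  ultimately have IH: "digit_content b \<beta> (n div b)
      = digit_content b \<beta> (n div b - b ^ k) + \<beta> ^ k"
    by (rule Suc.IH)
  obtain m where m: "n = m + b ^ k * b"
    using Suc.prems(1) by (metis le_Suc_ex add.commute power_Suc2)
  have "(n - b ^ Suc k) mod b = n mod b" "(n - b ^ Suc k) div b = n div b - b ^ k"
    using assms(1) by (simp_all add: m mult.commute[of b])
  then show ?case
    using IH by (simp add: rec[of n] rec[of "n - b ^ Suc k"] distrib_left del: power_Suc) simp
qed

text \<open>Digits are below \<open>b\<close>, so a geometric series bounds the content. The
  constant \<open>A\<close> is at least b / (\<beta> - 1), and subtracting it makes the induction
  close.\<close>

lemma digit_content_less_power: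
  assumes "b \<ge> 2" "1 \<le> \<beta>" "n < b ^ k" and A: "real b \<le> A * (\<beta> - 1)"
  shows "digit_content b \<beta> n \<le> A * \<beta> ^ k - A"
  using assms(3)
proof (induction k arbitrary: n)
  case (Suc k)
  have "n div b < b ^ k"
    using Suc.prems assms(1) by (simp add: less_mult_imp_div_less mult.commute)
  then have "\<beta> * digit_content b \<beta> (n div b) \<le> \<beta> * (A * \<beta> ^ k - A)"
    using assms(2) by (intro mult_left_mono Suc.IH) auto
  moreover have "n mod b < b" using assms(1) by simp
  ultimately show ?case
    using A by (simp add: digit_content_rec[OF assms(1), of _ n] algebra_simps)
qed simp

section \<open>Weights: digits of the quotient and a fractional last place\<close>

definition weight :: "nat \<Rightarrow> real \<Rightarrow> nat \<Rightarrow> nat \<Rightarrow> real" where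
  "weight b \<beta> d n = digit_content b \<beta> (n div d) + real (n mod d) / real d"

lemma weight_0 [simp]: "weight b \<beta> d 0 = 0"
  by (simp add: weight_def)

lemma weight_nonneg: "0 \<le> \<beta> \<Longrightarrow> 0 \<le> weight b \<beta> d n"
  by (simp add: weight_def digit_content_nonneg)

lemma weight_less: "n < d \<Longrightarrow> weight b \<beta> d n = real n / real d"
  by (simp add: weight_def)

lemma weight_mult: "0 < d \<Longrightarrow> weight b \<beta> d (d * n) = digit_content b \<beta> n"
  by (simp add: weight_def)

lemma weight_mult_power:
  assumes "2 \<le> b" "0 < d"
  shows "weight b \<beta> d (d * b ^ k) = \<beta> ^ k"
  using digit_content_mult_power[OF assms(1), of \<beta> 1 k] assms
  by (simp add: weight_mult digit_content_less)

text \<open>The remainder modulo \<open>d\<close> acts as one more place below the digits. A carry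
  out of it turns d / d into one unit of the quotient and costs nothing, here and in the reverse
  estimate.\<close>

lemma weight_add_le:
  assumes "2 \<le> b" "0 \<le> \<beta>" "\<beta> \<le> real b" "0 < d"
  shows "weight b \<beta> d (x + y) \<le> weight b \<beta> d x + weight b \<beta> d y"
proof -
  note le = digit_content_add_le[OF assms(1-3), of _ "x div d" "y div d"]
  have "(0::nat) \<le> 1" by simp
  with assms(4) show ?thesis
  proof (cases rule: add_carry[of d 0 x y])
    case no_carry
    then show ?thesis using le[of 0] by (simp add: weight_def add_divide_distrib)
  next
    case carry
    then show ?thesis using le[of 1] assms(4)
      by (simp add: weight_def add_divide_distrib diff_divide_distrib)
  qed
qed

lemma weight_add_ge:
  assumes "2 \<le> b" "0 \<le> \<beta>" "\<beta> \<le> real b" "0 < d" "x + y < d * b ^ Suc k"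
  shows "weight b \<beta> d x + weight b \<beta> d y
    \<le> weight b \<beta> d (x + y) + (real b - \<beta>) * (\<Sum>j<k. \<beta> ^ j)"
proof -
  note ge = digit_content_add_ge[OF assms(1-3), of _ "x div d" "y div d" k]
  have lt: "(x + y) div d < b ^ Suc k"
    using assms(4,5) by (simp add: less_mult_imp_div_less mult.commute)
  have "(0::nat) \<le> 1" by simp
  with assms(4) show ?thesis
  proof (cases rule: add_carry[of d 0 x y])
    case no_carry
    then show ?thesis using ge[of 0] lt by (simp add: weight_def add_divide_distrib)
  next
    case carry
    then show ?thesis using ge[of 1] lt assms(4)
      by (simp add: weight_def add_divide_distrib diff_divide_distrib)
  qed
qed

lemma weight_mult_le:
  assumes "2 \<le> b" "0 \<le> \<beta>" "\<beta> \<le> real b" "0 < d"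
  shows "weight b \<beta> d (t * x) \<le> real t * weight b \<beta> d x"
proof (induction t)
  case (Suc t)
  then show ?case using weight_add_le[OF assms, of x "t * x"] by (simp add: distrib_right)
qed simp

text \<open>Multiplying by \<open>d\<close> removes the fractional part:
  \<open>d * (i * b ^ k)\<close> has weight \<beta>^k times the content of \<open>i\<close>, hence
  at least \<beta>^k. Subadditivity bounds it by \<open>d\<close> times the weight of
  \<open>i * b ^ k\<close>.\<close>

lemma power_le_weight:
  assumes "2 \<le> b" "1 \<le> \<beta>" "\<beta> \<le> real b" "0 < d" "0 < i"
  shows "\<beta> ^ k \<le> real d * weight b \<beta> d (i * b ^ k)"
proof -
  have "\<beta> ^ k * 1 \<le> \<beta> ^ k * digit_content b \<beta> i"
    using assms by (intro mult_left_mono digit_content_ge_1) auto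
  also have "\<dots> = weight b \<beta> d (d * (i * b ^ k))"
    using assms by (simp only: weight_mult digit_content_mult_power)
  also have "\<dots> \<le> real d * weight b \<beta> d (i * b ^ k)"
    using assms by (intro weight_mult_le) auto
  finally show ?thesis by simp
qed

lemma weight_diff_power:
  assumes "2 \<le> b" "0 < d" "d * b ^ k \<le> n" "n < d * b ^ Suc k"
  shows "weight b \<beta> d n = weight b \<beta> d (n - d * b ^ k) + \<beta> ^ k"
proof -
  obtain m where m: "n = m + b ^ k * d"
    using assms(3) by (metis le_Suc_ex add.commute mult.commute)
  have "b ^ k \<le> n div d" "n div d < b ^ Suc k"
    using assms by (simp_all add: less_eq_div_iff_mult_less_eq div_less_iff_less_mult mult.commute)
  from digit_content_diff_power[OF assms(1) this, of \<beta>] show ?thesis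
    using assms(2) by (simp add: weight_def m mult.commute[of d])
qed

text \<open>
  The assumption on \<open>\<beta>\<close> says that two carry errors do not exceed \<open>\<beta>^k / d\<close>, a lower bound for the
  weight of \<open>(l - i) b^k\<close>.
\<close>
lemma weight_replace:
  assumes "2 \<le> b" "1 \<le> \<beta>" "\<beta> \<le> real b" "0 < d"
    and \<beta>: "2 * real d * (real b - \<beta>) \<le> \<beta> - 1"
    and "i < l" "l * b ^ k \<le> n" "n < d * b ^ Suc k"
  shows "weight b \<beta> d (n - l * b ^ k) + weight b \<beta> d (i * b ^ k) \<le> weight b \<beta> d n"
proof -
  define E where "E = (real b - \<beta>) * (\<Sum>j<k. \<beta> ^ j)"
  have \<beta>0: "0 \<le> \<beta>" using assms(2) by simp
  note ge = weight_add_ge[OF assms(1) \<beta>0 assms(3,4)]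
  have "2 * real d * E \<le> (\<beta> - 1) * (\<Sum>j<k. \<beta> ^ j)"
    unfolding E_def mult.assoc[symmetric] using \<beta> \<beta>0 by (intro mult_right_mono sum_nonneg) auto
  also have "\<dots> = \<beta> ^ k - 1" by (simp add: power_diff_1_eq)
  also have "\<dots> \<le> real d * weight b \<beta> d ((l - i) * b ^ k)"
    using power_le_weight[OF assms(1-4), of "l - i" k] assms(6) by simp
  finally have "2 * E \<le> weight b \<beta> d ((l - i) * b ^ k)"
    using assms(4) by simp
  \<comment> \<open>One error \<open>E\<close> arises from splitting \<open>n\<close> at
    \<open>l * b ^ k\<close>, the other from splitting \<open>l * b ^ k\<close> at
    \<open>i * b ^ k\<close>.\<close>
  moreover have "weight b \<beta> d (n - l * b ^ k) + weight b \<beta> d (l * b ^ k) \<le> weight b \<beta> d n + E"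
    using ge[of "n - l * b ^ k" "l * b ^ k" k] assms(7,8) unfolding E_def by simp
  moreover have "i * b ^ k + (l - i) * b ^ k = l * b ^ k"
    using assms(6) by (simp flip: distrib_right)
  then have "weight b \<beta> d (i * b ^ k) + weight b \<beta> d ((l - i) * b ^ k) \<le> weight b \<beta> d (l * b ^ k) + E"
    using ge[of "i * b ^ k" "(l - i) * b ^ k" k] assms(7,8) unfolding E_def by (simp del: power_Suc)
  ultimately show ?thesis by simp
qed

lemma weight_le_powr:
  assumes "2 \<le> b" "1 < \<beta>" "\<beta> < real b" "0 < d"
  shows "\<exists>\<alpha> C. 0 \<le> \<alpha> \<and> \<alpha> < 1 \<and> 0 \<le> C \<and> (\<forall>n. weight b \<beta> d n \<le> C * real (n + 1) powr \<alpha>)"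
proof (intro exI conjI allI)
  \<comment> \<open>With this exponent \<beta>^k = (b^k)^\<alpha>, and \<beta> < b gives \<alpha> <
    1.\<close>
  define \<alpha> where "\<alpha> = log (real b) \<beta>"
  define A where "A = real b / (\<beta> - 1)"
  show \<alpha>0: "0 \<le> \<alpha>" and "\<alpha> < 1"
    using assms by (simp_all add: \<alpha>_def)
  have A0: "0 \<le> A" using assms by (simp add: A_def)
  then show "0 \<le> A * \<beta> + 1" using assms(2) by simp
  fix n
  obtain k where k: "b ^ k \<le> n + 1" "n + 1 < b ^ (k + 1)"
    using ex_power_ivl1[OF assms(1), of "n + 1"] by auto
  have "n div d \<le> n" by simp
  then have "n div d < b ^ (k + 1)" using k(2) by linarith
  then have "digit_content b \<beta> (n div d) \<le> A * \<beta> ^ (k + 1) - A"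
    using assms by (intro digit_content_less_power) (auto simp: A_def)
  also have "\<dots> \<le> A * \<beta> * \<beta> ^ k" using A0 by simp
  also have "\<beta> ^ k = (real b powr \<alpha>) ^ k" using assms by (simp add: \<alpha>_def)
  also have "\<dots> = real (b ^ k) powr \<alpha>"
    using assms by (simp add: powr_powr mult.commute flip: powr_realpow)
  also have "A * \<beta> * real (b ^ k) powr \<alpha> \<le> A * \<beta> * real (n + 1) powr \<alpha>"
    using k(1) \<alpha>0 A0 assms(2) by (intro mult_left_mono powr_mono2) (auto simp flip: of_nat_power)
  finally have "digit_content b \<beta> (n div d) \<le> A * \<beta> * real (n + 1) powr \<alpha>" .
  moreover have "real (n mod d) / real d \<le> 1" using assms(4) by (simp add: less_imp_le)
  moreover have "1 \<le> real (n + 1) powr \<alpha>" using \<alpha>0 by (intro ge_one_powr_ge_zero) auto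
  ultimately show "weight b \<beta> d n \<le> (A * \<beta> + 1) * real (n + 1) powr \<alpha>"
    by (simp add: weight_def distrib_right)
qed

section \<open>Annihilating polynomials of a recursion\<close>

lemma finite_degree_less: "finite {r :: 'a::{finite,zero} poly. degree r < d}"
proof (rule finite_subset)
  show "{r :: 'a poly. degree r < d} \<subseteq> Poly ` {xs. set xs \<subseteq> UNIV \<and> length xs \<le> d}"
  proof
    fix r :: "'a poly" assume "r \<in> {r. degree r < d}"
    then have "length (coeffs r) \<le> d" by (cases "r = 0") (simp_all add: length_coeffs)
    then show "r \<in> Poly ` {xs. set xs \<subseteq> UNIV \<and> length xs \<le> d}"
      by (intro image_eqI[of _ _ "coeffs r"]) auto
  qed
  show "finite (Poly ` {xs :: 'a list. set xs \<subseteq> UNIV \<and> length xs \<le> d})"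
    by (intro finite_imageI finite_lists_length_le) simp
qed

text \<open>Division by a monic polynomial works over any commutative ring: multiply the remainder
  of X^n by X and cancel the coefficient at \<open>degree H\<close> with a multiple of
  \<open>H\<close>.\<close>

lemma monic_remainder_monom:
  fixes H :: "'a::comm_ring_1 poly"
  assumes "lead_coeff H = 1" "degree H \<ge> 1"
  shows "\<exists>r. degree r < degree H \<and> H dvd monom 1 n - r"
proof (induction n)
  case 0
  then show ?case using assms by (intro exI[of _ 1]) (simp add: monom_0 flip: one_pCons)
next
  case (Suc n)
  then obtain r where r: "degree r < degree H" "H dvd monom 1 n - r" by blast
  define c where "c = coeff r (degree H - 1)"
  define r' where "r' = pCons 0 r - smult c H"
  have "coeff r' k = 0" if "k \<ge> degree H" for k
  proof (cases "k = degree H")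
    case True
    then show ?thesis using assms by (simp add: r'_def c_def coeff_pCons split: nat.split)
  next
    case False
    then show ?thesis using that r(1)
      by (simp add: r'_def coeff_pCons coeff_eq_0 split: nat.split)
  qed
  then have "degree r' \<le> degree H - 1" by (intro degree_le) auto
  moreover have "monom 1 (Suc n) - r' = pCons 0 (monom 1 n - r) + smult c H"
    by (simp add: r'_def monom_Suc)
  moreover have "H dvd pCons 0 (monom 1 n - r) + smult c H"
    using dvd_mult[OF r(2), of "[:0, 1:]"] by (simp add: dvd_smult)
  ultimately show ?case using assms(2) by (metis One_nat_def Suc_pred le_imp_less_Suc less_eq_Suc_le)
qed

text \<open>X is invertible modulo \<open>H\<close>: from H = h + X A and u h = 1 follows 1 = u H -
  u A X. Multiplying this by \<open>F'\<close> removes one factor X.\<close>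

lemma dvd_monom_mult_cancel:
  fixes H F :: "'a::comm_ring_1 poly"
  assumes "coeff H 0 dvd 1" "H dvd monom 1 n * F"
  shows "H dvd F"
  using assms(2)
proof (induction n)
  case 0
  then show ?case by (simp add: monom_0)
next
  case (Suc n)
  obtain u where u: "coeff H 0 * u = 1" using assms(1) by (auto elim: dvdE)
  obtain h A where H: "H = pCons h A" by (cases H)
  define F' where "F' = monom 1 n * F"
  have "monom 1 (Suc n) * F = pCons 0 F'"
    by (simp add: F'_def monom_Suc)
  moreover have "F' = H * smult u F' - smult u A * pCons 0 F'"
    using u by (simp add: H smult_add_right mult.commute[of u h])
  ultimately have "H dvd F'"
    using Suc.prems by (metis dvd_diff dvd_mult dvd_triv_left)
  then show ?case using Suc.IH by (simp add: F'_def)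
qed

text \<open>Pigeonhole: there are finitely many remainders modulo \<open>H\<close>, so two powers of
  X are congruent, and the smaller one cancels because X is invertible modulo
  \<open>H\<close>.\<close>

lemma monic_unit_dvd_monom_minus_1:
  fixes H :: "'a::{comm_ring_1,finite} poly"
  assumes "lead_coeff H = 1" "degree H \<ge> 1" "coeff H 0 dvd 1"
  shows "\<exists>M\<ge>1. H dvd monom 1 M - 1"
proof -
  obtain r where r: "\<And>n. degree (r n) < degree H" "\<And>n. H dvd monom 1 n - r n"
    using monic_remainder_monom[OF assms(1,2)] by metis
  have "finite (range r)"
    by (rule finite_subset[OF _ finite_degree_less[of "degree H"]]) (use r(1) in auto)
  then have "\<not> inj r" using finite_imageD infinite_UNIV_nat by blast
  then obtain m n where mn: "m < n" "r m = r n"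
    by (metis injI linorder_neqE_nat)
  have "H dvd (monom 1 n - r n) - (monom 1 m - r m)" using r(2) r(2) by (rule dvd_diff)
  also have "\<dots> = monom 1 m * (monom 1 (n - m) - 1)"
    using mn by (simp add: mult_monom right_diff_distrib)
  finally have "H dvd monom 1 (n - m) - 1" using dvd_monom_mult_cancel assms(3) by blast
  then show ?thesis using mn(1) by (intro exI[of _ "n - m"]) auto
qed

text \<open>
  In an element \<open>F\<close> of \<open>R[y][X]\<close>, represented as a \<open>poly poly\<close>, the coefficient of \<open>y^i X^j\<close> is
  \<open>coeff (coeff F j) i\<close>.
\<close>
definition homogenize :: "nat \<Rightarrow> 'a::comm_ring_1 poly \<Rightarrow> 'a poly poly" where
  "homogenize n F = (\<Sum>j\<le>n. monom (monom (coeff F j) (n - j)) j)"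

lemma homogenize_add: "homogenize n (F + G) = homogenize n F + homogenize n G"
  by (simp add: homogenize_def sum.distrib flip: add_monom)

lemma homogenize_diff: "homogenize n (F - G) = homogenize n F - homogenize n G"
  by (simp add: homogenize_def sum_subtractf flip: diff_monom)

lemma homogenize_sum: "homogenize n (sum f A) = (\<Sum>x\<in>A. homogenize n (f x))"
  by (induction A rule: infinite_finite_induct)
     (simp_all add: homogenize_add, simp_all add: homogenize_def)

lemma homogenize_monom:
  "j \<le> n \<Longrightarrow> homogenize n (monom c j) = monom (monom c (n - j)) j"
  unfolding homogenize_def by (subst sum.remove[of _ j]) auto

text \<open>\<open>homogenize n F\<close> is y^n F(X/y), which is multiplicative as long as the
  degree bounds prevent truncation.\<close>

lemma homogenize_mult:
  assumes "degree F \<le> m" "degree G \<le> n"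
  shows "homogenize (m + n) (F * G) = homogenize m F * homogenize n G"
proof -
  have "F * G = (\<Sum>i\<le>m. \<Sum>j\<le>n. monom (coeff F i * coeff G j) (i + j))"
    unfolding mult_monom[symmetric] sum_product[symmetric] by (simp only: poly_as_sum_of_monoms' assms)
  then have "homogenize (m + n) (F * G)
      = (\<Sum>i\<le>m. \<Sum>j\<le>n. monom (monom (coeff F i * coeff G j) (m + n - (i + j))) (i + j))"
    by (simp add: homogenize_sum homogenize_monom)
  also have "\<dots> = homogenize m F * homogenize n G"
    unfolding homogenize_def sum_product by (intro sum.cong refl) (simp add: mult_monom)
  finally show ?thesis .
qed

text \<open>A strict bound as a predicate spares a convention for the total degree of 0, which
  satisfies it for every \<open>n\<close>.\<close>

definition total_degree_less :: "nat \<Rightarrow> 'a::comm_ring_1 poly poly \<Rightarrow> bool" where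
  "total_degree_less n F \<longleftrightarrow> (\<forall>i j. coeff (coeff F j) i \<noteq> 0 \<longrightarrow> i + j < n)"

lemma total_degree_less_sum:
  assumes "\<And>x. x \<in> A \<Longrightarrow> total_degree_less n (f x)"
  shows "total_degree_less n (sum f A)"
  unfolding total_degree_less_def coeff_sum
proof (intro allI impI)
  fix i j assume "(\<Sum>x\<in>A. coeff (coeff (f x) j) i) \<noteq> 0"
  then obtain x where "x \<in> A" "coeff (coeff (f x) j) i \<noteq> 0"
    by (rule sum.not_neutral_contains_not_neutral)
  then show "i + j < n" using assms unfolding total_degree_less_def by blast
qed

lemma total_degree_less_homogenize: "total_degree_less (Suc n) (homogenize n F)"
  unfolding homogenize_def
  by (rule total_degree_less_sum) (auto simp: total_degree_less_def)

lemma total_degree_less_mult: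
  assumes F: "total_degree_less m F" and G: "total_degree_less (Suc n) G"
  shows "total_degree_less (m + n) (F * G)"
  unfolding total_degree_less_def
proof (intro allI impI)
  fix i j assume "coeff (coeff (F * G) j) i \<noteq> 0"
  then have "(\<Sum>j'\<le>j. \<Sum>i'\<le>i. coeff (coeff F j') i' * coeff (coeff G (j - j')) (i - i')) \<noteq> 0"
    by (simp add: coeff_mult coeff_sum)
  then obtain j' where j': "j' \<le> j"
      "(\<Sum>i'\<le>i. coeff (coeff F j') i' * coeff (coeff G (j - j')) (i - i')) \<noteq> 0"
    by (auto elim: sum.not_neutral_contains_not_neutral)
  then obtain i' where i': "i' \<le> i"
      "coeff (coeff F j') i' * coeff (coeff G (j - j')) (i - i') \<noteq> 0"
    by (auto elim: sum.not_neutral_contains_not_neutral)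
  note ij = j'(1) i'
  have "coeff (coeff F j') i' \<noteq> 0" "coeff (coeff G (j - j')) (i - i') \<noteq> 0"
    using i'(2) by auto
  then have "i' + j' < m" "i - i' + (j - j') < Suc n"
    using F G unfolding total_degree_less_def by blast+
  then show "i + j < m + n" using ij by linarith
qed

definition charpoly :: "(nat \<Rightarrow> 'a::comm_ring_1 poly) \<Rightarrow> nat \<Rightarrow> 'a poly poly" where
  "charpoly a d = monom 1 d - (\<Sum>i=1..d. monom (a i) (d - i))"

text \<open>Setting y = 1 in the top form of \<open>charpoly a d\<close> gives \<open>H\<close>,
  monic with invertible constant term, so H G = X^M - 1 for some G. Homogenizing turns this into X^M
  - y^M. The rest of \<open>charpoly a d\<close> has total degree below \<open>d\<close>; its
  product with the homogenized G stays below \<open>M\<close>.\<close>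

lemma charpoly_multiple:
  fixes a :: "nat \<Rightarrow> 'a::{comm_ring_1,finite} poly"
  assumes "d \<ge> 1" and deg: "\<And>i. i \<in> {1..d} \<Longrightarrow> degree (a i) \<le> i" and unit: "coeff (a d) d dvd 1"
  shows "\<exists>M\<ge>1. \<exists>G L. charpoly a d * G = monom 1 M - (monom (monom 1 M) 0 + L) \<and> total_degree_less M L"
proof -
  define H where "H = monom 1 d - (\<Sum>i=1..d. monom (coeff (a i) i) (d - i))"
  have coeff_H: "coeff H k = (if k = d then 1 else 0) - (if k < d then coeff (a (d - k)) (d - k) else 0)" for k
  proof -
    have "(\<Sum>i=1..d. coeff (monom (coeff (a i) i) (d - i)) k)
        = (\<Sum>i=1..d. if i = d - k then (if k < d then coeff (a i) i else 0) else 0)"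
      by (intro sum.cong) auto
    then show ?thesis by (auto simp: H_def coeff_sum)
  qed
  have "degree H = d"
  proof (rule antisym)
    show "degree H \<le> d" by (rule degree_le) (simp add: coeff_H)
    show "d \<le> degree H" by (rule le_degree) (simp add: coeff_H)
  qed
  then have lead: "lead_coeff H = 1" by (simp add: coeff_H)
  obtain M G where M: "M \<ge> 1" "monom 1 M - 1 = H * G"
    using monic_unit_dvd_monom_minus_1[OF lead] assms(1) unit \<open>degree H = d\<close>
    by (auto simp: coeff_H elim!: dvdE)
  \<comment> \<open>\<open>H\<close> is monic, so degrees add despite zero divisors; the bound on
    \<open>degree G\<close> keeps homogenization in degree \<open>M - d\<close> from truncating
    \<open>G\<close>.\<close>
  have "degree G \<le> M - d" "d \<le> M"
  proof -
    have "coeff (monom 1 M - 1) k = (if k = M then 1 else 0)" if "k \<ge> 1" for k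
      using that by simp
    then have nz: "G \<noteq> 0" using M by (metis coeff_0 mult_zero_right zero_neq_one)
    then have "coeff (monom 1 M - 1 :: 'a poly) (d + degree G) \<noteq> 0"
      using lead coeff_mult_degree_sum[of H G] by (simp add: M(2) \<open>degree H = d\<close>)
    then have "d + degree G = M" using assms(1) by (auto simp: coeff_1 split: if_splits)
    then show "degree G \<le> M - d" "d \<le> M" by auto
  qed
  then have hom: "homogenize d H * homogenize (M - d) G = monom 1 M - monom (monom 1 M) 0"
  proof -
    have "homogenize d H * homogenize (M - d) G = homogenize (d + (M - d)) (H * G)"
      using \<open>degree G \<le> M - d\<close> \<open>degree H = d\<close> by (simp add: homogenize_mult)
    also have "\<dots> = homogenize M (monom 1 M - monom 1 0)"
      using \<open>d \<le> M\<close> M(2) by simp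
    also have "\<dots> = monom 1 M - monom (monom 1 M) 0"
      by (simp add: homogenize_diff homogenize_monom del: monom_eq_1) simp
    finally show ?thesis .
  qed
  define L where "L = (\<Sum>i=1..d. monom (a i - monom (coeff (a i) i) i) (d - i))"
  have "homogenize d H = monom 1 d - (\<Sum>i=1..d. monom (monom (coeff (a i) i) i) (d - i))"
    by (simp add: H_def homogenize_diff homogenize_sum homogenize_monom)
  then have char: "charpoly a d = homogenize d H - L"
    by (simp add: charpoly_def L_def sum_subtractf flip: diff_monom)
  have "total_degree_less d L"
    unfolding L_def
  proof (rule total_degree_less_sum)
    fix i assume i: "i \<in> {1..d}"
    show "total_degree_less d (monom (a i - monom (coeff (a i) i) i) (d - i))"
      unfolding total_degree_less_def
    proof (intro allI impI)
      fix k j assume "coeff (coeff (monom (a i - monom (coeff (a i) i) i) (d - i)) j) k \<noteq> 0"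
      then have "j = d - i" "coeff (a i) k \<noteq> 0" "k \<noteq> i" by (auto split: if_splits)
      moreover have "k \<le> degree (a i)" by (rule le_degree) fact
      ultimately show "k + j < d" using deg[OF i] i by auto
    qed
  qed
  then have "total_degree_less (d + (M - d)) (L * homogenize (M - d) G)"
    by (intro total_degree_less_mult total_degree_less_homogenize)
  moreover have "charpoly a d * homogenize (M - d) G
      = monom 1 M - (monom (monom 1 M) 0 + L * homogenize (M - d) G)"
    unfolding char left_diff_distrib hom by simp
  ultimately show ?thesis using M(1) \<open>d \<le> M\<close> by auto
qed

section \<open>Evaluation of polynomials in the shift on a sequence\<close>

definition linear_extension :: "(nat \<Rightarrow> 'a::comm_ring_1) \<Rightarrow> 'a poly \<Rightarrow> 'a" where
  "linear_extension s F = (\<Sum>j\<le>degree F. coeff F j * s j)"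

lemma linear_extension_eq:
  assumes "degree F \<le> n"
  shows "linear_extension s F = (\<Sum>j\<le>n. coeff F j * s j)"
  unfolding linear_extension_def
  by (rule sum.mono_neutral_left) (use assms in \<open>auto simp: coeff_eq_0 not_le\<close>)

lemma linear_extension_add: "linear_extension s (F + G) = linear_extension s F + linear_extension s G"
  using linear_extension_eq[of F "max (degree F) (degree G)" s]
    linear_extension_eq[of G "max (degree F) (degree G)" s]
    linear_extension_eq[of "F + G" "max (degree F) (degree G)" s]
  by (simp add: degree_add_le distrib_right sum.distrib)

lemma linear_extension_smult: "linear_extension s (smult c F) = c * linear_extension s F"
  using linear_extension_eq[of "smult c F" "degree F" s]
  by (simp add: linear_extension_def sum_distrib_left mult.assoc degree_smult_le)

lemma linear_extension_0 [simp]: "linear_extension s 0 = 0"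
  by (simp add: linear_extension_def)

lemma linear_extension_diff: "linear_extension s (F - G) = linear_extension s F - linear_extension s G"
  using linear_extension_add[of s "F - G" G] by simp

lemma linear_extension_sum: "linear_extension s (sum f A) = (\<Sum>x\<in>A. linear_extension s (f x))"
  by (induction A rule: infinite_finite_induct) (simp_all add: linear_extension_add)

lemma linear_extension_monom: "linear_extension s (monom c n) = c * s n"
proof -
  have "(\<Sum>j\<le>n. coeff (monom c n) j * s j) = (\<Sum>j\<le>n. if j = n then c * s j else 0)"
    by (intro sum.cong) auto
  then show ?thesis by (simp add: linear_extension_eq[of _ n] degree_monom_le)
qed

text \<open>By linearity it suffices to take \<open>monom c n\<close> for \<open>G\<close>, where
  the claim is \<open>c\<close> times the recursion at \<open>n + d\<close>.\<close>

lemma linear_extension_charpoly: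
  fixes a s :: "nat \<Rightarrow> 'a::comm_ring_1 poly"
  assumes rec: "\<And>n. n \<ge> d \<Longrightarrow> s n = (\<Sum>i=1..d. a i * s (n - i))"
  shows "linear_extension s (charpoly a d * G) = 0"
proof -
  have *: "linear_extension s (charpoly a d * monom c n) = 0" for c n
  proof -
    have "charpoly a d * monom c n = monom c (n + d) - (\<Sum>i=1..d. monom (a i * c) (n + d - i))"
      by (simp add: charpoly_def left_diff_distrib sum_distrib_right mult_monom add.commute)
    then have "linear_extension s (charpoly a d * monom c n) = c * s (n + d) - (\<Sum>i=1..d. a i * c * s (n + d - i))"
      by (simp add: linear_extension_diff linear_extension_sum linear_extension_monom)
    also have "s (n + d) = (\<Sum>i=1..d. a i * s (n + d - i))" by (rule rec) simp
    finally show ?thesis by (simp add: sum_distrib_left algebra_simps)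
  qed
  have "charpoly a d * G = (\<Sum>j\<le>degree G. charpoly a d * monom (coeff G j) j)"
    by (simp add: poly_as_sum_of_monoms flip: sum_distrib_left)
  then show ?thesis by (simp add: linear_extension_sum *)
qed

section \<open>Frobenius modulo a prime\<close>

lemma prime_dvd_add_power:
  fixes x y :: "'a::comm_ring_1"
  assumes "prime p"
  shows "of_nat p dvd (x + y) ^ p - (x ^ p + y ^ p)"
proof -
  have p: "p > 0" using assms by (simp add: prime_gt_0_nat)
  have "(x + y) ^ p = (\<Sum>k\<le>p. of_nat (p choose k) * x ^ k * y ^ (p - k))"
    by (rule binomial_ring)
  also have "\<dots> = (\<Sum>k\<in>{0,p}. of_nat (p choose k) * x ^ k * y ^ (p - k))
      + (\<Sum>k\<in>{..p}-{0,p}. of_nat (p choose k) * x ^ k * y ^ (p - k))"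
    by (subst sum.subset_diff[of "{0,p}"]) (auto simp: add.commute)
  also have "(\<Sum>k\<in>{0,p}. of_nat (p choose k) * x ^ k * y ^ (p - k)) = x ^ p + y ^ p"
    using p by (simp add: add.commute)
  finally have "(x + y) ^ p - (x ^ p + y ^ p)
      = (\<Sum>k\<in>{..p}-{0,p}. of_nat (p choose k) * x ^ k * y ^ (p - k))" by simp
  moreover have "of_nat p dvd of_nat (p choose k) * x ^ k * y ^ (p - k)"
    if "k \<in> {..p} - {0, p}" for k
  proof -
    have "p dvd p choose k" using that assms p by (intro dvd_choose_prime) auto
    then have "(of_nat p :: 'a) dvd of_nat (p choose k)" by auto
    then show ?thesis by (simp add: mult.assoc)
  qed
  ultimately show ?thesis by (simp only:) (rule dvd_sum)
qed

lemma prime_dvd_sum_power: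
  fixes f :: "'b \<Rightarrow> 'a::comm_ring_1"
  assumes "prime p"
  shows "of_nat p dvd sum f A ^ p - (\<Sum>x\<in>A. f x ^ p)"
proof (induction A rule: infinite_finite_induct)
  case (insert x A)
  have "sum f (insert x A) ^ p - (\<Sum>x\<in>insert x A. f x ^ p)
     = ((f x + sum f A) ^ p - (f x ^ p + sum f A ^ p)) + (sum f A ^ p - (\<Sum>x\<in>A. f x ^ p))"
    using insert.hyps by simp
  then show ?case using insert.IH prime_dvd_add_power[OF assms, of "f x" "sum f A"]
    by (metis dvd_add)
qed (use assms in \<open>auto simp: power_0_left\<close>)

lemma prime_dvd_sum_prime_power:
  fixes f :: "'b \<Rightarrow> 'a::comm_ring_1"
  assumes "prime p"
  shows "of_nat p dvd sum f A ^ (p ^ k) - (\<Sum>x\<in>A. f x ^ (p ^ k))"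
proof (induction k)
  case (Suc k)
  define g where "g = (\<lambda>x. f x ^ (p ^ k))"
  \<comment> \<open>x - y divides x^p - y^p, so the congruence for \<open>k\<close> survives taking
    \<open>p\<close>-th powers.\<close>
  have "(sum f A ^ p ^ k - sum g A) dvd (sum f A ^ p ^ k) ^ p - sum g A ^ p"
    unfolding power_diff_sumr2 by (rule dvd_triv_left)
  then have "of_nat p dvd (sum f A ^ p ^ k) ^ p - sum g A ^ p"
    using Suc dvd_trans unfolding g_def by blast
  from dvd_add[OF this prime_dvd_sum_power[OF assms, of g A]]
  show ?case by (simp add: g_def mult.commute flip: power_mult)
qed simp

text \<open>With q = p^k, the product P G = X^M - K divides X^(M q) - K^q, and modulo
  \<open>p\<close> the power K^q is the sum of the q-th powers of the terms of \<open>K\<close>.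
  Multiplying by X^n and applying \<open>linear_extension s\<close> gives the recursion.
  \<open>A\<close> may exceed the support of \<open>K\<close>, as additional terms vanish.\<close>

lemma prime_power_recursion:
  fixes s :: "nat \<Rightarrow> 'a::comm_ring_1 poly" and P G K :: "'a poly poly"
  assumes "prime p" and van: "\<And>F. linear_extension s (P * F) = 0"
    and PG: "P * G = monom 1 M - K"
    and A: "finite A" "\<And>i j. coeff (coeff K j) i \<noteq> 0 \<Longrightarrow> (i, j) \<in> A"
  shows "of_nat p dvd s (n + M * p ^ k) - (\<Sum>(i,j)\<in>A.
     monom (coeff (coeff K j) i ^ p ^ k) (i * p ^ k) * s (n + j * p ^ k))"
proof -
  define f where "f = (\<lambda>(i,j). monom (monom (coeff (coeff K j) i) i) j)"
  define q where "q = p ^ k"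
  have K: "K = sum f A"
  proof (intro poly_eqI)
    fix i j
    have "coeff (coeff (sum f A) j) i = (\<Sum>x\<in>A. if x = (i, j) then coeff (coeff K j) i else 0)"
      unfolding coeff_sum by (intro sum.cong) (auto simp: f_def split: if_splits)
    then show "coeff (coeff K j) i = coeff (coeff (sum f A) j) i"
      using A by auto
  qed
  obtain E where E: "K ^ q - (\<Sum>x\<in>A. f x ^ q) = of_nat p * E"
    using prime_dvd_sum_prime_power[OF assms(1), of f A k] unfolding K q_def by (auto elim: dvdE)
  have "monom 1 M - K dvd monom 1 M ^ q - K ^ q"
    unfolding power_diff_sumr2 by (rule dvd_triv_left)
  then obtain Z where Z: "monom 1 M ^ q - K ^ q = P * G * Z" unfolding PG by (auto elim: dvdE)
  have "0 = linear_extension s (P * (G * Z * monom 1 n))" by (simp only: van)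
  also have "P * (G * Z * monom 1 n) = monom 1 n * (monom 1 M ^ q - K ^ q)"
    unfolding Z by (simp add: mult_ac)
  also have "K ^ q = (\<Sum>x\<in>A. f x ^ q) + of_nat p * E"
    using E by (simp add: algebra_simps)
  also have "monom 1 n * (monom 1 M ^ q - \<dots>)
      = monom 1 (n + M * q) - (\<Sum>x\<in>A. monom 1 n * f x ^ q) - smult (of_nat p) (monom 1 n * E)"
    by (simp add: monom_power mult_monom algebra_simps sum_distrib_left of_nat_poly[where ?'a = "'a poly"])
  also have "linear_extension s \<dots> = s (n + M * q) - (\<Sum>x\<in>A. linear_extension s (monom 1 n * f x ^ q))
      - of_nat p * linear_extension s (monom 1 n * E)"
    by (simp add: linear_extension_diff linear_extension_sum linear_extension_monom linear_extension_smult)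
  also have "(\<Sum>x\<in>A. linear_extension s (monom 1 n * f x ^ q)) = (\<Sum>(i,j)\<in>A.
     monom (coeff (coeff K j) i ^ q) (i * q) * s (n + j * q))"
    by (intro sum.cong) (auto simp: f_def monom_power mult_monom linear_extension_monom)
  finally show ?thesis unfolding q_def by (simp add: dvd_def) (metis eq_iff_diff_eq_0)
qed

section \<open>Descent of the weight modulo a prime\<close>

lemma of_nat_dvd_coeff:
  fixes F :: "'a::comm_ring_1 poly"
  assumes "of_nat q dvd F"
  shows "of_nat q dvd coeff F m"
  using assms by (auto simp: of_nat_poly elim!: dvdE)

lemma of_nat_dvd_polyI:
  fixes F :: "'a::comm_ring_1 poly"
  assumes "\<And>m. of_nat q dvd coeff F m"
  shows "of_nat q dvd F"
proof -
  obtain e where e: "\<And>m. coeff F m = of_nat q * e m"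
    using assms unfolding dvd_def by metis
  have "F = (\<Sum>j\<le>degree F. of_nat q * monom (e j) j)"
    by (subst (1) poly_as_sum_of_monoms[symmetric])
       (simp add: e smult_monom of_nat_poly[where ?'a = 'a])
  then show ?thesis unfolding sum_distrib_left[symmetric] by (rule dvdI)
qed

text \<open>Induction on \<open>n\<close>. For \<open>n < M\<close> the drop in degree alone lowers
  the weight by 1 / M. For larger \<open>n\<close>, a coefficient of \<open>s n\<close> not
  divisible by \<open>p\<close> stems from such a coefficient at a smaller index, shifted by y^(i
  q), and the shift regains no more weight than the index has lost.\<close>

lemma weight_decreases:
  fixes s :: "nat \<Rightarrow> 'a::comm_ring_1 poly" and P G L :: "'a poly poly"
  assumes p: "prime p" and \<beta>: "1 \<le> \<beta>" "\<beta> \<le> real p" "2 * real M * (real p - \<beta>) \<le> \<beta> - 1"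
    and M: "0 < M"
    and low: "\<And>n m. coeff (s n) m \<noteq> 0 \<Longrightarrow> m < n"
    and van: "\<And>F. linear_extension s (P * F) = 0"
    and PG: "P * G = monom 1 M - (monom (monom 1 M) 0 + L)"
    and L: "total_degree_less M L"
    and nz: "\<not> of_nat p dvd coeff (s n) m"
  shows "weight p \<beta> M m \<le> weight p \<beta> M n - 1 / real M"
  using nz
proof (induction n arbitrary: m rule: less_induct)
  case (less n)
  have p2: "2 \<le> p" using p by (rule prime_ge_2_nat)
  have \<beta>0: "0 \<le> \<beta>" using \<beta> by simp
  show ?case
  proof (cases "n < M")
    case True
    have "m < n" using less.prems low by (metis dvd_0_right)
    then have "real m + 1 \<le> real n" by simp
    then show ?thesis
      using True \<open>m < n\<close> M by (simp add: weight_less field_simps)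
  next
    case False
    then have "n div M \<ge> 1" using M by (simp add: Suc_le_eq div_greater_zero_iff)
    \<comment> \<open>\<open>k\<close> is the place of the leading digit of \<open>n div M\<close>:
      steps of size p^k are possible, and the carry estimate below M p^(k+1) applies.\<close>
    then obtain k where k: "p ^ k \<le> n div M" "n div M < p ^ (k + 1)"
      using ex_power_ivl1[OF p2] by blast
    define q where "q = p ^ k"
    have q: "q > 0" using p2 by (simp add: q_def)
    have n: "M * q \<le> n" "n < M * p ^ Suc k"
      using k M unfolding q_def
      by (simp_all add: less_eq_div_iff_mult_less_eq div_less_iff_less_mult mult.commute)
    define K where "K = monom (monom 1 M) 0 + L"
    \<comment> \<open>\<open>(M, 0)\<close> is the main term y^M; the other pairs cover
      \<open>L\<close>.\<close>
    define A where "A = insert (M, 0) {(i, j). i + j < M}"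
    define t where "t = (\<lambda>(i, j). coeff (monom (coeff (coeff K j) i ^ q) (i * q) * s (n - M * q + j * q)) m)"
    have "finite {(i, j). i + j < M}"
      by (rule finite_subset[of _ "{..M} \<times> {..M}"]) auto
    then have "finite A" by (simp add: A_def)
    moreover have "(i, j) \<in> A" if "coeff (coeff K j) i \<noteq> 0" for i j
      using that L unfolding K_def A_def total_degree_less_def by (fastforce split: if_splits)
    ultimately have "of_nat p dvd s (n - M * q + M * q) - (\<Sum>(i,j)\<in>A.
        monom (coeff (coeff K j) i ^ q) (i * q) * s (n - M * q + j * q))"
      unfolding q_def by (rule prime_power_recursion[OF p van PG[folded K_def]])
    from of_nat_dvd_coeff[OF this, of m]
    have dvd: "of_nat p dvd coeff (s n) m - (\<Sum>x\<in>A. t x)"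
      unfolding le_add_diff_inverse2[OF n(1)] t_def
      by (simp only: coeff_diff coeff_sum case_prod_unfold)
    have "\<exists>x\<in>A. \<not> of_nat p dvd t x"
    proof (rule ccontr)
      assume "\<not> (\<exists>x\<in>A. \<not> of_nat p dvd t x)"
      then have "of_nat p dvd (\<Sum>x\<in>A. t x)" by (intro dvd_sum) blast
      from dvd_add[OF dvd this] show False using less.prems by simp
    qed
    then obtain i j where ij: "(i, j) \<in> A" "\<not> of_nat p dvd t (i, j)" by auto
    then have m: "i * q \<le> m" and nd: "\<not> of_nat p dvd coeff (s (n - M * q + j * q)) (m - i * q)"
      by (auto simp: t_def coeff_monom_mult split: if_splits)
    have "j < M" using ij(1) M by (auto simp: A_def)
    then have jq: "j * q \<le> M * q" by simp
    then have shift: "n - M * q + j * q = n - (M - j) * q"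
      using n(1) by (simp add: diff_mult_distrib)
    have "(M - j) * q > 0" "M * q > 0" using \<open>j < M\<close> M q by simp_all
    then have "n - (M - j) * q < n" using n(1) by (intro diff_less) linarith+
    then have IH: "weight p \<beta> M (m - i * q) \<le> weight p \<beta> M (n - (M - j) * q) - 1 / real M"
      using less.IH nd unfolding shift by blast
    have "weight p \<beta> M m \<le> weight p \<beta> M (m - i * q) + weight p \<beta> M (i * q)"
      using weight_add_le[OF p2 \<beta>0 \<beta>(2) M, of "m - i * q" "i * q"] m by simp
    \<comment> \<open>The main term lowers the leading digit of the quotient by one and gains
      \<beta>^k back from y^(M q). In the other terms \<open>i < M - j\<close>, so the loss covers
      the gain despite carries.\<close>
    moreover have "weight p \<beta> M (n - (M - j) * q) + weight p \<beta> M (i * q) \<le> weight p \<beta> M n"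
    proof (cases "(i, j) = (M, 0)")
      case True
      then show ?thesis
        using weight_diff_power[OF p2 M, of k n \<beta>] n weight_mult_power[OF p2 M, of \<beta> k]
        by (simp add: q_def)
    next
      case False
      then have "i < M - j" using ij(1) by (auto simp: A_def)
      moreover have "(M - j) * q \<le> n"
        using n(1) by (meson diff_le_self le_trans mult_le_mono1)
      ultimately show ?thesis
        using weight_replace[OF p2 \<beta>(1,2) M \<beta>(3), of i "M - j" k n] n(2) by (simp add: q_def)
    qed
    ultimately show ?thesis using IH by simp
  qed
qed

section \<open>Iterates of \<open>T\<close> and composite moduli\<close>

lemma linear_funpow:
  fixes T :: "'a::comm_ring_1 poly \<Rightarrow> 'a poly"
  assumes "module_hom smult smult T"
  shows "module_hom smult smult (T ^^ k)"
  using assms by (induction k) (simp_all add: module_hom_iff)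

lemma linear_expand:
  fixes T :: "'a::comm_ring_1 poly \<Rightarrow> 'a poly"
  assumes "module_hom smult smult T" "degree f \<le> n"
  shows "T f = (\<Sum>j\<le>n. smult (coeff f j) (T (monom 1 j)))"
proof -
  interpret module_hom smult smult T by fact
  have "T f = T (\<Sum>j\<le>n. smult (coeff f j) (monom 1 j))"
    using assms(2) by (simp add: smult_monom poly_as_sum_of_monoms')
  then show ?thesis by (simp add: sum scale)
qed

lemma degree_funpow_le:
  fixes T :: "'a::zero poly \<Rightarrow> 'a poly"
  assumes "\<And>f. degree (T f) \<le> degree f"
  shows "degree ((T ^^ k) f) \<le> degree f"
proof (induction k)
  case (Suc k)
  then show ?case using assms[of "(T ^^ k) f"] by simp
qed simp

text \<open>The base \<open>n + 1\<close> and \<open>0 \<le> \<alpha>\<close> make the threshold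
  usable at \<open>n = 0\<close> and monotone in \<open>n\<close>, so that one \<open>k\<close>
  serves all monomials of degree at most \<open>n\<close>.\<close>

definition sublinear_mod :: "('a::comm_ring_1 poly \<Rightarrow> 'a poly) \<Rightarrow> nat \<Rightarrow> bool" where
  "sublinear_mod T q \<longleftrightarrow> (\<exists>\<alpha> C. 0 \<le> \<alpha> \<and> \<alpha> < 1 \<and> 0 \<le> C \<and>
     (\<forall>n k. C * real (n + 1) powr \<alpha> \<le> real k \<longrightarrow> of_nat q dvd (T ^^ k) (monom 1 n)))"

text \<open>
  The monomials of \<open>T^k1 (y^n)\<close> have degree at most \<open>n\<close> and coefficients divisible by \<open>q1\<close>, and
  \<open>T^k2\<close> contributes the factor \<open>q2\<close> to the image of each of them.
\<close>
lemma sublinear_mod_mult: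
  assumes lin: "module_hom smult smult T" and deg: "\<And>f. degree (T f) \<le> degree f"
    and "sublinear_mod T q1" "sublinear_mod T q2"
  shows "sublinear_mod T (q1 * q2)"
proof -
  from assms(3) obtain \<alpha>1 C1 where 1: "0 \<le> \<alpha>1" "\<alpha>1 < 1" "0 \<le> C1"
    "\<And>n k. C1 * real (n + 1) powr \<alpha>1 \<le> real k \<Longrightarrow> of_nat q1 dvd (T ^^ k) (monom 1 n)"
    unfolding sublinear_mod_def by blast
  from assms(4) obtain \<alpha>2 C2 where 2: "0 \<le> \<alpha>2" "\<alpha>2 < 1" "0 \<le> C2"
    "\<And>n k. C2 * real (n + 1) powr \<alpha>2 \<le> real k \<Longrightarrow> of_nat q2 dvd (T ^^ k) (monom 1 n)"
    unfolding sublinear_mod_def by blast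
  define \<alpha> where "\<alpha> = max \<alpha>1 \<alpha>2"
  have "of_nat (q1 * q2) dvd (T ^^ k) (monom 1 n)"
    if k: "(C1 + C2 + 1) * real (n + 1) powr \<alpha> \<le> real k" for n k
  proof -
    define N where "N = real (n + 1) powr \<alpha>"
    have N1: "1 \<le> N" unfolding N_def using 1 by (intro ge_one_powr_ge_zero) (auto simp: \<alpha>_def)
    \<comment> \<open>The summand 1 in \<open>C1 + C2 + 1\<close> pays for this rounding, since
      \<open>N\<close> is at least 1.\<close>
    define k1 where "k1 = nat \<lceil>C1 * N\<rceil>"
    have "C1 * N \<le> real k1" unfolding k1_def by linarith
    have "0 \<le> C1 * N" using 1 N1 by simp
    then have "real k1 \<le> C1 * N + 1" unfolding k1_def by linarith
    then have "C2 * N \<le> real k - real k1"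
      using k N1 unfolding N_def[symmetric] by (simp add: distrib_right)
    moreover from this have "k1 \<le> k" using 2 N1 by (smt (verit) mult_nonneg_nonneg of_nat_le_iff)
    ultimately have k2: "C2 * N \<le> real (k - k1)" by (simp add: of_nat_diff)
    define g where "g = (T ^^ k1) (monom 1 n)"
    have "real (n + 1) powr \<alpha>1 \<le> N"
      unfolding N_def by (intro powr_mono) (auto simp: \<alpha>_def)
    then have "C1 * real (n + 1) powr \<alpha>1 \<le> real k1"
      using \<open>C1 * N \<le> real k1\<close> 1(3) by (meson mult_left_mono order_trans)
    then have "of_nat q1 dvd g" unfolding g_def by (rule 1)
    have "degree g \<le> n"
      using degree_funpow_le[of T k1, OF deg] degree_monom_le[of 1 n] unfolding g_def by (meson order_trans)
    have "(T ^^ k) (monom 1 n) = (T ^^ (k - k1)) g"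
      using \<open>k1 \<le> k\<close> by (simp add: g_def flip: funpow_add comp_apply[of "T ^^ (k - k1)" "T ^^ k1"])
    also have "\<dots> = (\<Sum>j\<le>n. smult (coeff g j) ((T ^^ (k - k1)) (monom 1 j)))"
      by (rule linear_expand[OF linear_funpow[OF lin] \<open>degree g \<le> n\<close>])
    also have "of_nat (q1 * q2) dvd \<dots>"
    proof (rule dvd_sum)
      fix j assume "j \<in> {..n}"
      then have "real (j + 1) powr \<alpha>2 \<le> real (n + 1) powr \<alpha>2"
        using 2 by (intro powr_mono2) auto
      also have "\<dots> \<le> N" unfolding N_def by (intro powr_mono) (auto simp: \<alpha>_def)
      finally have "C2 * real (j + 1) powr \<alpha>2 \<le> real (k - k1)"
        using k2 2(3) by (meson mult_left_mono order_trans)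
      then have "of_nat q2 dvd (T ^^ (k - k1)) (monom 1 j)" by (rule 2)
      moreover have "of_nat q1 dvd [:coeff g j:]"
        using of_nat_dvd_coeff[OF \<open>of_nat q1 dvd g\<close>]
        by (intro of_nat_dvd_polyI) (auto simp: coeff_pCons split: nat.split)
      ultimately have "of_nat q1 * of_nat q2 dvd [:coeff g j:] * (T ^^ (k - k1)) (monom 1 j)"
        by (intro mult_dvd_mono)
      then show "of_nat (q1 * q2) dvd smult (coeff g j) ((T ^^ (k - k1)) (monom 1 j))" by simp
    qed
    finally show ?thesis .
  qed
  moreover have "0 \<le> \<alpha>" "\<alpha> < 1" "0 \<le> C1 + C2 + 1" using 1 2 by (auto simp: \<alpha>_def)
  ultimately show ?thesis unfolding sublinear_mod_def by blast
qed

lemma sublinear_mod_prime: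
  fixes T :: "'a::{comm_ring_1,finite} poly \<Rightarrow> 'a poly" and a :: "nat \<Rightarrow> 'a poly"
  assumes lin: "module_hom smult smult T"
    and low: "\<And>n m. coeff (T (monom 1 n)) m \<noteq> 0 \<Longrightarrow> m < n"
    and "d \<ge> 1" and deg: "\<And>i. i \<in> {1..d} \<Longrightarrow> degree (a i) \<le> i"
    and rec: "\<And>n. n \<ge> d \<Longrightarrow> T (monom 1 n) = (\<Sum>i=1..d. a i * T (monom 1 (n - i)))"
    and unit: "coeff (a d) d dvd 1"
    and p: "prime p"
  shows "sublinear_mod T p"
proof -
  define s where "s = (\<lambda>n. T (monom 1 n))"
  obtain M G L where M: "M \<ge> 1" and PG: "charpoly a d * G = monom 1 M - (monom (monom 1 M) 0 + L)"
    and L: "total_degree_less M L"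
    using charpoly_multiple[OF assms(3) deg unit] by blast
  have van: "linear_extension s (charpoly a d * F) = 0" for F
    by (rule linear_extension_charpoly) (simp add: s_def rec)
  \<comment> \<open>Chosen so that 2 M (p - \<beta>) = 1/2, which is at most \<beta> - 1 because p
    \<ge> 2.\<close>
  define \<beta> where "\<beta> = real p - 1 / (4 * real M)"
  have p2: "p \<ge> 2" using p by (rule prime_ge_2_nat)
  have "1 / (4 * real M) \<le> 1 / 4" "0 < 1 / (4 * real M)" using M by (auto simp: field_simps)
  moreover have "2 \<le> real p" using p2 by simp
  ultimately have \<beta>: "1 < \<beta>" "\<beta> < real p" "1 / 2 \<le> \<beta> - 1" unfolding \<beta>_def by linarith+
  have "2 * real M * (real p - \<beta>) = 1 / 2" using M by (simp add: \<beta>_def)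
  then have \<beta>': "2 * real M * (real p - \<beta>) \<le> \<beta> - 1" using \<beta> by simp
  define w where "w = weight p \<beta> M"
  have step: "w m \<le> w n - 1 / real M" if "\<not> of_nat p dvd coeff (s n) m" for n m
    unfolding w_def
    by (rule weight_decreases[OF p _ _ \<beta>' _ _ van PG L that]) (use \<beta> M low in \<open>auto simp: s_def\<close>)
  \<comment> \<open>A coefficient not divisible by \<open>p\<close> can be traced back from exponent
    \<open>m\<close> to \<open>n\<close> through \<open>k\<close> applications of \<open>T\<close>,
    each costing at least 1 / M of weight.\<close>
  have desc: "w m \<le> w n - real k / real M" if "\<not> of_nat p dvd coeff ((T ^^ k) (monom 1 n)) m" for n m k
    using that
  proof (induction k arbitrary: m)
    case 0
    then show ?case by (auto split: if_splits)
  next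
    case (Suc k)
    define f where "f = (T ^^ k) (monom 1 n)"
    have "coeff (T f) m = (\<Sum>j\<le>degree f. coeff f j * coeff (s j) m)"
      using linear_expand[OF lin order_refl, of f] by (simp add: coeff_sum s_def)
    then have "\<not> of_nat p dvd (\<Sum>j\<le>degree f. coeff f j * coeff (s j) m)"
      using Suc.prems by (simp add: f_def)
    then obtain j where "\<not> of_nat p dvd coeff f j * coeff (s j) m"
      by (meson dvd_sum)
    then have "\<not> of_nat p dvd coeff f j" "\<not> of_nat p dvd coeff (s j) m" by auto
    then show ?case using Suc.IH[of j] step[of j m] by (simp add: f_def add_divide_distrib)
  qed
  obtain \<alpha> B where B: "0 \<le> \<alpha>" "\<alpha> < 1" "0 \<le> B" "\<And>n. w n \<le> B * real (n + 1) powr \<alpha>"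
    using weight_le_powr[OF p2 \<beta>(1,2), of M] M unfolding w_def by auto
  \<comment> \<open>Weights are nonnegative, so the descent has at most M times the weight of y^n
    steps; \<open>B + 1\<close> in place of \<open>B\<close> makes the contradiction strict.\<close>
  have "of_nat p dvd (T ^^ k) (monom 1 n)"
    if k: "real M * (B + 1) * real (n + 1) powr \<alpha> \<le> real k" for n k
  proof (rule of_nat_dvd_polyI, rule ccontr)
    fix m assume "\<not> of_nat p dvd coeff ((T ^^ k) (monom 1 n)) m"
    then have "real k / real M \<le> w n - w m" using desc by fastforce
    also have "\<dots> \<le> w n" using \<beta> by (simp add: w_def weight_nonneg)
    also have "\<dots> \<le> B * real (n + 1) powr \<alpha>" by (rule B)
    also have "\<dots> < (B + 1) * real (n + 1) powr \<alpha>" by (simp add: distrib_right)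
    also have "\<dots> \<le> real k / real M" using k M by (simp add: field_simps)
    finally show False by simp
  qed
  then show ?thesis unfolding sublinear_mod_def using B M
    by (intro exI[of _ \<alpha>] exI[of _ "real M * (B + 1)"]) auto
qed

lemma sublinear_mod_pos:
  assumes lin: "module_hom smult smult T" and deg: "\<And>f. degree (T f) \<le> degree f"
    and prime: "\<And>p. prime p \<Longrightarrow> sublinear_mod T p" and "q > 0"
  shows "sublinear_mod T q"
  using \<open>q > 0\<close>
proof (induction q rule: less_induct)
  case (less q)
  show ?case
  proof (cases "q = 1")
    case True
    then show ?thesis unfolding sublinear_mod_def by (intro exI[of _ 0]) simp
  next
    case False
    then obtain p r where "prime p" "q = p * r" by (meson prime_factor_nat dvdE)
    moreover have "0 < r" "r < q"
      using less.prems \<open>q = p * r\<close> prime_gt_1_nat[OF \<open>prime p\<close>] by auto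
    ultimately show ?thesis using sublinear_mod_mult[OF lin deg] prime less.IH by blast
  qed
qed

theorem theorem3p1:
  fixes T :: "'a::{comm_ring_1, finite} poly \<Rightarrow> 'a poly"
    and a :: "nat \<Rightarrow> 'a poly" and d :: nat
  assumes linear: "module_hom smult smult T"
    and lowers: "\<And>f. f \<noteq> 0 \<Longrightarrow> deg (T f) < deg f"
    and d_pos: "d \<ge> 1"
    and deg_a: "\<And>i. i \<in> {1..d} \<Longrightarrow> deg (a i) \<le> ereal (real i)"
    and recursion: "\<And>n. n \<ge> d \<Longrightarrow>
          T (monom 1 n) = (\<Sum>i=1..d. a i * T (monom 1 (n - i)))"
    and unit: "coeff (a d) d dvd 1"
  shows "\<exists>\<alpha>::real. \<alpha> < 1 \<and>
           (\<lambda>n. nilpotence_index T (monom 1 n)) \<lless> (\<lambda>n. real n powr \<alpha>)"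
proof -
  have T0: "T 0 = 0" using linear by (rule module_hom.zero)
  have low: "m < n" if "coeff (T (monom 1 n)) m \<noteq> 0" for n m
  proof -
    have "T (monom 1 n) \<noteq> 0" using that by auto
    then have "degree (T (monom 1 n)) < n"
      using lowers[of "monom 1 n"] by (simp add: deg_def degree_monom_eq)
    moreover have "m \<le> degree (T (monom 1 n))" using that by (rule le_degree)
    ultimately show ?thesis by simp
  qed
  \<comment> \<open>The inequality is weak because a nonzero constant is sent to 0, and the library
    gives both \<open>degree\<close> 0.\<close>
  have deg: "degree (T f) \<le> degree f" for f
    using lowers[of f] T0 by (cases "f = 0") (auto simp: deg_def split: if_splits)
  have deg_a': "degree (a i) \<le> i" if "i \<in> {1..d}" for i
    using deg_a[OF that] by (auto simp: deg_def split: if_splits)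
  \<comment> \<open>A finite ring has positive characteristic, and in R[y] only 0 is divisible by
    it.\<close>
  have "CHAR('a) > 0" by (rule finite_imp_CHAR_pos) simp
  moreover have "sublinear_mod T p" if "prime p" for p
    using linear low d_pos deg_a' recursion unit that by (rule sublinear_mod_prime)
  ultimately have "sublinear_mod T CHAR('a)"
    using sublinear_mod_pos[OF linear deg] by blast
  then obtain \<alpha> C where C: "0 \<le> \<alpha>" "\<alpha> < 1" "0 \<le> C"
    "\<And>n k. C * real (n + 1) powr \<alpha> \<le> real k \<Longrightarrow> (T ^^ k) (monom 1 n) = 0"
    unfolding sublinear_mod_def by (auto simp: of_nat_poly[where ?'a = 'a])
  have "nilpotence_index T (monom 1 n) \<le> ereal (C * 2 powr \<alpha> * real n powr \<alpha>)" if "n \<ge> 1" for n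
  proof -
    define K where "K = {k. (T ^^ k) (monom 1 n) \<noteq> 0}"
    have K: "real k < C * real (n + 1) powr \<alpha>" if "k \<in> K" for k
      using C(4) that unfolding K_def by (metis (mono_tags) mem_Collect_eq not_le)
    have "K \<subseteq> {..nat \<lceil>C * real (n + 1) powr \<alpha>\<rceil>}"
    proof
      fix k assume "k \<in> K"
      from K[OF this] show "k \<in> {..nat \<lceil>C * real (n + 1) powr \<alpha>\<rceil>}"
        unfolding atMost_iff by linarith
    qed
    then have "finite K" by (rule finite_subset) simp
    moreover have "0 \<in> K" by (simp add: K_def)
    ultimately have "Max K \<in> K" by (intro Max_in) auto
    then have "real (Max K) \<le> C * real (n + 1) powr \<alpha>" using K by (simp add: less_imp_le)
    \<comment> \<open>\<open>n + 1\<close> is at most \<open>2 * n\<close> for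
      \<open>n \<ge> 1\<close>, whence the factor 2^\<alpha>.\<close>
    also have "\<dots> \<le> C * (2 * real n) powr \<alpha>"
      using that C by (intro mult_left_mono powr_mono2) auto
    also have "\<dots> = C * 2 powr \<alpha> * real n powr \<alpha>" by (simp add: powr_mult)
    finally show ?thesis by (simp add: nilpotence_index_def K_def)
  qed
  then have "(\<lambda>n. nilpotence_index T (monom 1 n)) \<lless> (\<lambda>n. real n powr \<alpha>)"
    unfolding vinogradov_le_def
    by (intro exI[of _ "C * 2 powr \<alpha>"] eventually_sequentiallyI[of 1]) simp
  then show ?thesis using C(2) by blast
qed

end
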